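(* There exists a strictly increasing absolutely continuous function $f: [0,1] \rightarrow \mathbb{R}$ such that the set $\{x \in [0,1] : f'(x)=0\}$ is both countable and dense in $[0,1]$.
   Context: The set $\{x \in [0,1]: f'(x)=0\}$ consists of the points $x\in[0,1]$ at which the derivative $f'(x)$ exists and equals $0$ (at the endpoints $0$ and $1$ the derivative is one-sided, i.e. taken within $[0,1]$). *)

theory Defs
  imports "HOL-Analysis.Analysis"
begin

(* The classical epsilon-delta notion for functions on an interval S; it is unrelated to the
   library's measure-theoretic constant absolutely_continuous.  A finite family of pairwise
   disjoint open intervals is given by the finite set P of the pairs of their endpoints;
   disjoint nonempty intervals have different endpoint pairs, so a set loses nothing. *)
definition absolutely_continuous_on :: "real set \<Rightarrow> (real \<Rightarrow> real) \<Rightarrow> bool" where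
  "absolutely_continuous_on S f \<longleftrightarrow>
    (\<forall>\<epsilon>>0. \<exists>\<delta>>0. \<forall>P :: (real \<times> real) set.
       finite P \<longrightarrow>
       (\<forall>(a, b) \<in> P. a < b \<and> {a..b} \<subseteq> S) \<longrightarrow>
       pairwise (\<lambda>(a, b) (c, d). disjnt {a<..<b} {c<..<d}) P \<longrightarrow>
       (\<Sum>(a, b) \<in> P. b - a) < \<delta> \<longrightarrow>
       (\<Sum>(a, b) \<in> P. \<bar>f b - f a\<bar>) < \<epsilon>)"

end

theory Submission
  imports Defs
begin

text \<open>
  Enumerate the rationals of the unit interval as \<open>q 0, q 1, \<dots>\<close> and attach to \<open>q m\<close> a ball of
  radius \<open>r m\<close>, minute compared with its distances to the earlier points. The density \<open>g\<close> is the
  wedge \<open>\<bar>t - q m\<bar> / r m\<close> for the last ball containing \<open>t\<close>, so each new ball overrides the previous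
  value instead of shrinking it further, and \<open>f\<close> is an integral of \<open>g\<close>. The later balls
  occupy only a set of measure \<open>O(h^2)\<close> within distance \<open>h\<close> of \<open>q n\<close>, so \<open>f\<close> has derivative zero at \<open>q n\<close>.

  Let \<open>x\<close> be irrational. If \<open>x\<close> lies in infinitely many of the fourfold enlarged balls, then \<open>f\<close>
  grows by at least \<open>r m / 2\<close> across each of these balls, and the derivative at \<open>x\<close> is not zero.
  Otherwise there is a last ball \<open>N\<close> containing \<open>x\<close>; since the first later ball meeting a short
  interval around \<open>x\<close> is short and all further ones are negligible, \<open>g\<close> agrees with the
  wedge of \<open>q N\<close> on half of that interval, where it is bounded below by a positive constant.
\<close>

section \<open>Calculus and measure preliminaries\<close>

lemma abs_diff_has_integral:
  fixes a h :: real
  assumes "h \<ge> 0"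
  shows "((\<lambda>t. \<bar>t - a\<bar>) has_integral h\<^sup>2) {a - h..a + h}"
proof -
  have "((\<lambda>t. \<bar>t - a\<bar>) has_integral (- ((a - a)\<^sup>2 / 2) - (- ((a - h - a)\<^sup>2 / 2)))) {a - h..a}"
    by (rule fundamental_theorem_of_calculus_interior)
      (use assms in \<open>auto simp: has_real_derivative_iff_has_vector_derivative[symmetric] diff_divide_distrib
        intro!: derivative_eq_intros continuous_intros\<close>)
  moreover have "((\<lambda>t. \<bar>t - a\<bar>) has_integral ((a + h - a)\<^sup>2 / 2 - (a - a)\<^sup>2 / 2)) {a..a + h}"
    by (rule fundamental_theorem_of_calculus_interior)
      (use assms in \<open>auto simp: has_real_derivative_iff_has_vector_derivative[symmetric] diff_divide_distrib
        intro!: derivative_eq_intros continuous_intros\<close>)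
  ultimately have "((\<lambda>t. \<bar>t - a\<bar>) has_integral (h\<^sup>2 / 2 + h\<^sup>2 / 2)) {a - h..a + h}"
    using has_integral_combine[of "a - h" a "a + h"] assms by fastforce
  then show ?thesis by simp
qed

lemma absolutely_continuous_on_lipschitz:
  assumes "\<And>x y. x \<in> S \<Longrightarrow> y \<in> S \<Longrightarrow> x \<le> y \<Longrightarrow> \<bar>f y - f x\<bar> \<le> y - x"
  shows "absolutely_continuous_on S f"
  unfolding absolutely_continuous_on_def
proof (intro allI impI)
  fix \<epsilon> :: real assume "\<epsilon> > 0"
  have "(\<Sum>(a, b) \<in> P. \<bar>f b - f a\<bar>) < \<epsilon>"
    if "\<forall>(a, b) \<in> P. a < b \<and> {a..b} \<subseteq> S" "(\<Sum>(a, b) \<in> P. b - a) < \<epsilon>" for P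
  proof -
    have "(\<Sum>(a, b) \<in> P. \<bar>f b - f a\<bar>) \<le> (\<Sum>(a, b) \<in> P. b - a)"
      by (rule sum_mono) (use that(1) assms in \<open>force simp: subset_iff\<close>)
    with that(2) show ?thesis by simp
  qed
  with \<open>\<epsilon> > 0\<close> show "\<exists>\<delta>>0. \<forall>P. finite P \<longrightarrow> (\<forall>(a, b) \<in> P. a < b \<and> {a..b} \<subseteq> S) \<longrightarrow>
       pairwise (\<lambda>(a, b) (c, d). disjnt {a<..<b} {c<..<d}) P \<longrightarrow>
       (\<Sum>(a, b) \<in> P. b - a) < \<delta> \<longrightarrow> (\<Sum>(a, b) \<in> P. \<bar>f b - f a\<bar>) < \<epsilon>"
    by blast
qed

lemma bounded_borel_integrable_on:
  fixes f :: "real \<Rightarrow> real"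
  assumes "f \<in> borel_measurable borel" "\<And>t. \<bar>f t\<bar> \<le> B"
  shows "f integrable_on {a..b}"
proof (rule set_borel_integral_eq_integral(1))
  show "set_integrable lborel {a..b} f"
    unfolding set_integrable_def
    by (rule integrableI_bounded_set_indicator[where B = B]) (use assms in \<open>auto simp: emeasure_lborel_Icc_eq\<close>)
qed

lemma has_real_derivative_zero_bound:
  fixes f :: "real \<Rightarrow> real"
  assumes "(f has_real_derivative 0) (at x)" "\<epsilon> > 0"
  obtains d where "d > 0" "\<And>y. \<bar>y - x\<bar> < d \<Longrightarrow> \<bar>f y - f x\<bar> \<le> \<epsilon> * \<bar>y - x\<bar>"
  using assms unfolding has_field_derivative_def has_derivative_at_alt by fastforce

section \<open>The rational centres and their balls\<close>

locale rational_enumeration =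
  fixes q :: "nat \<Rightarrow> real"
  assumes bij: "bij_betw q UNIV (\<rat> \<inter> {0..1})"
begin

lemma q_in: "q n \<in> \<rat>" "0 \<le> q n" "q n \<le> 1"
  using bij_betwE[OF bij] by auto

lemma q_neq: "m \<noteq> n \<Longrightarrow> q m \<noteq> q n"
  using bij by (auto simp: bij_betw_def inj_on_def)

lemma q_surj: "x \<in> \<rat> \<Longrightarrow> 0 \<le> x \<Longrightarrow> x \<le> 1 \<Longrightarrow> \<exists>n. x = q n"
  using bij by (auto simp: bij_betw_def image_iff set_eq_iff)

text \<open>The squared distances make \<open>r m\<close> quadratically small near each earlier
  centre, the powers of 1/16 make the radii summable, and all radii are rational. The empty product
  gives \<open>r 0 = 1\<close>.\<close>

definition r :: "nat \<Rightarrow> real" where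
  "r m = (1 / 16) ^ m * (\<Prod>n<m. (q m - q n)\<^sup>2)"

text \<open>This is where the wedge of index \<open>n\<close> can be overridden.\<close>

definition U :: "nat \<Rightarrow> real set" where
  "U n = (\<Union>m\<in>{n<..}. cball (q m) (r m))"

text \<open>
  The summands have disjoint supports; \<open>g\<close> vanishes at the points lying in no ball or in
  infinitely many of them.
\<close>
definition g :: "real \<Rightarrow> real" where
  "g t = (\<Sum>m. indicator (cball (q m) (r m) - U m) t * (\<bar>t - q m\<bar> / r m))"

text \<open>
  The integral starts at \<open>-1\<close> because the balls around points near \<open>0\<close> leave the unit interval.
\<close>
definition f :: "real \<Rightarrow> real" where
  "f x = integral {-1..x} g"

lemma q_dist_sq: "(q m - q n)\<^sup>2 \<le> 1"
  using q_in(2,3)[of m] q_in(2,3)[of n] by (simp add: abs_square_le_1 abs_le_iff)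

lemma r_pos: "0 < r m"
  unfolding r_def using q_neq by (auto intro!: mult_pos_pos prod_pos)

lemma r_le: "r m \<le> (1 / 16) ^ m"
  unfolding r_def using q_dist_sq by (auto intro!: mult_left_le prod_le_1)

lemma r_le_1: "r m \<le> 1"
  using r_le[of m] power_le_one[of "1/16::real" m] by simp

text \<open>Rational radii keep irrational points off the boundaries of the balls.\<close>

lemma r_Rats: "r m \<in> \<rat>"
  unfolding r_def by (auto intro!: Rats_mult Rats_power Rats_prod Rats_diff q_in)

lemma r_le_dist:
  assumes "n < m"
  shows "r m \<le> (1 / 16) ^ m * (q m - q n)\<^sup>2"
proof -
  have "(\<Prod>k<m. (q m - q k)\<^sup>2) = (q m - q n)\<^sup>2 * (\<Prod>k\<in>{..<m} - {n}. (q m - q k)\<^sup>2)"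
    using assms by (intro prod.remove) auto
  also have "\<dots> \<le> (q m - q n)\<^sup>2 * 1"
    by (intro mult_left_mono prod_le_1) (use q_dist_sq in auto)
  finally show ?thesis unfolding r_def by (auto intro!: mult_left_mono)
qed

lemma U_borel: "U n \<in> sets borel"
  unfolding U_def by auto

text \<open>If a later ball \<open>m\<close> meets the \<open>h\<close>-ball about
  \<open>q n\<close>, then \<open>r m\<close> is small against the distance of the centres, which is
  therefore \<open>O(h)\<close>. Hence \<open>r m\<close> is \<open>O(h^2)\<close> with a geometric
  factor, and the lengths sum.\<close>

lemma measure_U_cball:
  assumes "h > 0"
  shows "emeasure lborel (U n \<inter> cball (q n) h) \<le> ennreal (h\<^sup>2 / 2)"
proof -
  define A where "A m = (if n < m \<and> cball (q m) (r m) \<inter> cball (q n) h \<noteq> {} then cball (q m) (r m) else {})" for m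
  \<comment> \<open>Indices above \<open>n\<close> are positive, so \<open>(1 / 16) ^ m\<close> is
    at most 1/16; the union below is shifted by \<open>Suc\<close> accordingly.\<close>
  have bound: "emeasure lborel (A m) \<le> ennreal ((1 / 16) ^ m * (32 / 9 * h\<^sup>2))" if "m > 0" for m
  proof (cases "n < m \<and> cball (q m) (r m) \<inter> cball (q n) h \<noteq> {}")
    case True
    then obtain t where "\<bar>q m - t\<bar> \<le> r m" "\<bar>q n - t\<bar> \<le> h" by (auto simp: dist_real_def)
    then have d: "\<bar>q m - q n\<bar> \<le> h + r m" by linarith
    have "r m \<le> (1 / 16) ^ m * \<bar>q m - q n\<bar>\<^sup>2" using r_le_dist True by simp
    also have "\<dots> \<le> (1 / 16) ^ 1 * \<bar>q m - q n\<bar> ^ 1"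
      using that q_dist_sq[of m n] 
      by (intro mult_mono power_decreasing) (auto simp: abs_square_le_1)
    finally have "\<bar>q m - q n\<bar> \<le> 4 / 3 * h" using d assms by simp
    then have "\<bar>q m - q n\<bar>\<^sup>2 \<le> (4 / 3 * h)\<^sup>2" by (intro power_mono) auto
    then have "(1 / 16) ^ m * \<bar>q m - q n\<bar>\<^sup>2 \<le> (1 / 16) ^ m * (16 / 9 * h\<^sup>2)"
      by (intro mult_left_mono) (auto simp: power2_eq_square)
    then have "2 * r m \<le> (1 / 16) ^ m * (32 / 9 * h\<^sup>2)"
      using r_le_dist[of n m] True unfolding power2_abs by linarith
    then show ?thesis using True r_pos[of m]
      by (auto simp: A_def cball_eq_atLeastAtMost intro!: ennreal_leI)
  next
    case False
    then show ?thesis unfolding A_def by (simp only: if_False) simp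
  qed
  have "U n \<inter> cball (q n) h \<subseteq> (\<Union>m. A (Suc m))"
  proof
    fix t assume t: "t \<in> U n \<inter> cball (q n) h"
    then obtain m where "m > n" "t \<in> cball (q m) (r m)" by (auto simp: U_def)
    with t have "t \<in> A m" by (auto simp: A_def)
    with \<open>m > n\<close> show "t \<in> (\<Union>m. A (Suc m))" by (metis UN_iff UNIV_I gr0_implies_Suc less_zeroE neq0_conv)
  qed
  then have "emeasure lborel (U n \<inter> cball (q n) h) \<le> emeasure lborel (\<Union>m. A (Suc m))"
    by (intro emeasure_mono) (auto simp: A_def)
  also have "\<dots> \<le> (\<Sum>m. emeasure lborel (A (Suc m)))"
    by (intro emeasure_subadditive_countably) (auto simp: A_def)
  also have "\<dots> \<le> (\<Sum>m. ennreal ((1 / 16) ^ Suc m * (32 / 9 * h\<^sup>2)))"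
    by (intro suminf_le bound) auto
  also have "\<dots> = ennreal (32 / 135 * h\<^sup>2)"
  proof (rule suminf_ennreal_eq)
    have "(\<lambda>m. (1 / 16 :: real) ^ m * (2 / 9 * h\<^sup>2)) sums (1 / (1 - 1 / 16) * (2 / 9 * h\<^sup>2))"
      by (intro sums_mult2 geometric_sums) auto
    then show "(\<lambda>m. (1 / 16) ^ Suc m * (32 / 9 * h\<^sup>2)) sums (32 / 135 * h\<^sup>2)"
      by (simp add: ac_simps)
  qed auto
  also have "\<dots> \<le> ennreal (h\<^sup>2 / 2)" by (intro ennreal_leI) simp
  finally show ?thesis .
qed

section \<open>The density\<close>

lemma g_eq:
  assumes "t \<in> cball (q m) (r m)" "t \<notin> U m"
  shows "g t = \<bar>t - q m\<bar> / r m"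
proof -
  \<comment> \<open>For \<open>k < m\<close> the point lies in \<open>U k\<close>; for
    \<open>k > m\<close> it lies outside ball \<open>k\<close>.\<close>
  have "t \<notin> cball (q k) (r k) - U k" if "k \<noteq> m" for k
    using that assms by (cases k m rule: linorder_cases) (auto simp: U_def)
  then have "(\<lambda>k. indicator (cball (q k) (r k) - U k) t * (\<bar>t - q k\<bar> / r k)) sums
      (indicator (cball (q m) (r m) - U m) t * (\<bar>t - q m\<bar> / r m))"
    by (intro sums_single[THEN sums_cong[THEN iffD1, rotated]]) (auto simp: indicator_def)
  with assms show ?thesis by (simp add: g_def sums_iff)
qed

lemma g_range: "0 \<le> g t" "g t \<le> 1"
proof -
  have "0 \<le> g t \<and> g t \<le> 1"
  proof (cases "\<exists>m. t \<in> cball (q m) (r m) - U m")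
    case True
    then obtain m where m: "t \<in> cball (q m) (r m)" "t \<notin> U m" by blast
    then show ?thesis using g_eq[OF m] r_pos[of m] by (auto simp: dist_real_def)
  next
    case False
    then have "indicator (cball (q m) (r m) - U m) t = (0::real)" for m
      by (metis indicator_simps(2))
    then show ?thesis by (simp add: g_def)
  qed
  then show "0 \<le> g t" "g t \<le> 1" by auto
qed

lemma g_borel: "g \<in> borel_measurable borel"
  unfolding g_def
  by (intro borel_measurable_suminf borel_measurable_times borel_measurable_indicator sets.Diff U_borel)
    auto

lemma g_integrable: "g integrable_on {a..b}"
  by (rule bounded_borel_integrable_on[OF g_borel, where B = 1]) (use g_range in auto)

section \<open>Increments of the integral\<close>

lemma f_diff:
  assumes "-1 \<le> x" "x \<le> y"
  shows "f y - f x = integral {x..y} g"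
  using Henstock_Kurzweil_Integration.integral_combine[OF assms g_integrable] by (simp add: f_def)

lemma f_diff_nonneg:
  assumes "-1 \<le> x" "x \<le> y"
  shows "0 \<le> f y - f x"
  unfolding f_diff[OF assms] using g_range g_integrable by (intro integral_nonneg) auto

lemma f_diff_le:
  assumes "-1 \<le> x" "x \<le> y"
  shows "f y - f x \<le> y - x"
proof -
  have "integral {x..y} g \<le> integral {x..y} (\<lambda>_. 1)"
    by (intro integral_le g_integrable g_range) auto
  then show ?thesis using assms f_diff[OF assms] by simp
qed

lemma indicator_U_integrable: "(indicator (U n) :: real \<Rightarrow> real) integrable_on {a..b}"
  by (rule bounded_borel_integrable_on[where B = 1])
    (auto intro!: borel_measurable_indicator U_borel simp: indicator_def)

text \<open>Carries bounds on Lebesgue measure over to the gauge integral.\<close>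

lemma integral_indicator_U:
  assumes "U n \<inter> {a..b} \<subseteq> A" "A \<in> sets borel" "emeasure lborel A \<le> ennreal c" "c \<ge> 0"
  shows "integral {a..b} (indicator (U n)) \<le> c"
proof -
  have sets: "U n \<inter> {a..b} \<in> sets borel" using U_borel by auto
  have le: "emeasure lborel (U n \<inter> {a..b}) \<le> ennreal c"
    using emeasure_mono[of "U n \<inter> {a..b}" A lborel] assms by auto
  then have "U n \<inter> {a..b} \<in> lmeasurable"
    using sets by (auto simp: fmeasurable_def less_top[symmetric] top_unique)
  then have "integral {a..b} (indicator (U n)) = measure lborel (U n \<inter> {a..b})"
    using sets by (simp add: Equivalence_Lebesgue_Henstock_Integration.integral_indicator)
  also have "\<dots> \<le> c" using le assms(4) by (simp add: measure_def enn2real_leI)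
  finally show ?thesis .
qed

text \<open>The wedge has integral \<open>h^2 / r n\<close>. The density differs from it only on
  \<open>U n\<close>, by at most 1, and this costs at most \<open>h^2 / 2\<close>, which is below
  \<open>h^2 / (2 * r n)\<close> since \<open>r n \<le> 1\<close>.\<close>

lemma f_ball:
  assumes "0 < h" "h \<le> r n"
  shows "h\<^sup>2 / (2 * r n) \<le> f (q n + h) - f (q n - h)" (is ?lower)
    and "f (q n + h) - f (q n - h) \<le> 2 * h\<^sup>2 / r n" (is ?upper)
proof -
  define a b where "a = q n - h" and "b = q n + h"
  have ab: "-1 \<le> a" "a \<le> b" using assms q_in(2)[of n] r_le_1[of n] by (auto simp: a_def b_def)
  have bump: "((\<lambda>t. \<bar>t - q n\<bar> / r n) has_integral h\<^sup>2 / r n) {a..b}"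
    unfolding a_def b_def using assms by (intro has_integral_divide abs_diff_has_integral) auto
  have ind: "(indicat_real (U n) has_integral integral {a..b} (indicator (U n))) {a..b}"
    using indicator_U_integrable by (rule integrable_integral)
  have g: "(g has_integral (f b - f a)) {a..b}"
    unfolding f_diff[OF ab] using g_integrable by (rule integrable_integral)
  have "integral {a..b} (indicator (U n)) \<le> h\<^sup>2 / 2"
    by (rule integral_indicator_U[where A = "U n \<inter> cball (q n) h"])
      (use measure_U_cball[OF assms(1)] U_borel in \<open>auto simp: a_def b_def dist_real_def\<close>)
  also have "\<dots> \<le> h\<^sup>2 / (2 * r n)" using r_pos[of n] r_le_1[of n] by (intro divide_left_mono) auto
  finally have *: "integral {a..b} (indicator (U n)) \<le> h\<^sup>2 / (2 * r n)" .
  have g_eq': "g t = \<bar>t - q n\<bar> / r n" if "t \<in> {a..b}" "t \<notin> U n" for t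
    using that assms by (intro g_eq) (auto simp: a_def b_def dist_real_def)
  have small: "0 \<le> \<bar>t - q n\<bar> / r n \<and> \<bar>t - q n\<bar> / r n \<le> 1" if "t \<in> {a..b}" for t
    using that assms r_pos[of n] by (auto simp: a_def b_def)
  have bounds: "\<bar>t - q n\<bar> / r n - indicator (U n) t \<le> g t" "g t \<le> \<bar>t - q n\<bar> / r n + indicator (U n) t"
    if "t \<in> {a..b}" for t
    using g_eq'[OF that] small[OF that] g_range[of t] by (cases "t \<in> U n"; simp)+
  have "h\<^sup>2 / r n - integral {a..b} (indicator (U n)) \<le> f b - f a"
    by (rule has_integral_le[OF has_integral_diff[OF bump ind] g])
      (rule bounds(1))
  then show ?lower using * by (simp add: a_def b_def)
  have "f b - f a \<le> h\<^sup>2 / r n + integral {a..b} (indicator (U n))"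
    by (rule has_integral_le[OF g has_integral_add[OF bump ind]])
      (rule bounds(2))
  moreover have "0 \<le> h\<^sup>2 / r n" using r_pos[of n] by simp
  ultimately show ?upper using * by (simp add: a_def b_def)
qed

lemma f_strict_mono: "strict_mono_on {0..1} f"
proof (rule strict_mono_onI)
  fix x y :: real assume xy: "x \<in> {0..1}" "y \<in> {0..1}" "x < y"
  obtain z where "z \<in> \<rat>" "x < z" "z < y" using Rats_dense_in_real[OF xy(3)] by blast
  with xy obtain n where n: "x < q n" "q n < y" using q_surj[of z] by auto
  define h where "h = min (r n) (min (q n - x) (y - q n))"
  have h: "0 < h" "h \<le> r n" "x \<le> q n - h" "q n + h \<le> y" using n r_pos[of n] by (auto simp: h_def)
  have "0 < h\<^sup>2 / (2 * r n)" using h r_pos[of n] by simp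
  also have "\<dots> \<le> f (q n + h) - f (q n - h)" using f_ball(1) h by blast
  also have "\<dots> \<le> f y - f x"
    using f_diff_nonneg[of x "q n - h"] f_diff_nonneg[of "q n + h" y] h xy by auto
  finally show "f x < f y" by simp
qed

text \<open>By monotonicity, an increment from \<open>q n\<close> is at most the growth across the
  symmetric ball, which is quadratic in its radius.\<close>

lemma f_deriv_q: "(f has_real_derivative 0) (at (q n))"
  unfolding has_field_derivative_iff
proof (rule Lim_null_comparison)
  have "\<forall>\<^sub>F y in at (q n). y \<noteq> q n \<and> \<bar>y - q n\<bar> < r n"
    unfolding eventually_at using r_pos[of n] by (auto simp: dist_real_def)
  then show "\<forall>\<^sub>F y in at (q n). norm ((f y - f (q n)) / (y - q n)) \<le> 2 / r n * \<bar>y - q n\<bar>"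
  proof eventually_elim
    case (elim y)
    define h where "h = \<bar>y - q n\<bar>"
    have h: "0 < h" "h \<le> r n" using elim by (auto simp: h_def)
    have low: "-1 \<le> q n - h" "-1 \<le> q n" "-1 \<le> y" "q n - h \<le> y" "y \<le> q n + h"
      using h q_in(2)[of n] r_le_1[of n] by (auto simp: h_def)
    have "\<bar>f y - f (q n)\<bar> \<le> f (q n + h) - f (q n - h)"
      using low f_diff_nonneg[of "q n - h" y] f_diff_nonneg[of y "q n + h"]
        f_diff_nonneg[of "q n - h" "q n"] f_diff_nonneg[of "q n" "q n + h"] h
      by linarith
    also have "\<dots> \<le> 2 * h\<^sup>2 / r n" using f_ball(2) h by blast
    finally show ?case using h r_pos[of n] by (simp add: h_def[symmetric] abs_divide divide_simps power2_eq_square)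
  qed
  show "((\<lambda>y. 2 / r n * \<bar>y - q n\<bar>) \<longlongrightarrow> 0) (at (q n))"
    using r_pos[of n] by (auto intro!: tendsto_eq_intros)
qed

section \<open>Irrational points\<close>

lemma f_deriv_nonzero:
  assumes x: "0 < x" "x < 1" "x \<notin> \<rat>"
  shows "\<not> (f has_real_derivative 0) (at x)"
proof
  assume deriv: "(f has_real_derivative 0) (at x)"
  have r_lim: "r \<longlonglongrightarrow> 0"
  proof (rule Lim_null_comparison)
    show "\<forall>\<^sub>F m in sequentially. norm (r m) \<le> (1 / 16) ^ m"
      using r_le r_pos by (auto simp: abs_of_pos)
  qed (auto intro: LIMSEQ_power_zero)
  show False
  proof (cases "\<exists>\<^sub>F m in sequentially. \<bar>x - q m\<bar> \<le> 4 * r m")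
    case True
    \<comment> \<open>Both ends of ball \<open>m\<close> are within \<open>5 * r m\<close> of
      \<open>x\<close>, so slope 1/30 allows a total growth of only \<open>r m / 3\<close>, less
      than the actual \<open>r m / 2\<close>.\<close>
    obtain d where d: "d > 0" "\<And>y. \<bar>y - x\<bar> < d \<Longrightarrow> \<bar>f y - f x\<bar> \<le> 1 / 30 * \<bar>y - x\<bar>"
      using has_real_derivative_zero_bound[OF deriv, of "1 / 30"] by auto
    have "\<forall>\<^sub>F m in sequentially. r m < d / 5"
      using d by (intro order_tendstoD(2)[OF r_lim]) auto
    with True obtain m where m: "\<bar>x - q m\<bar> \<le> 4 * r m" "r m < d / 5"
      using frequently_ex[OF frequently_eventually_conj] by blast
    have y: "\<bar>q m + r m - x\<bar> \<le> 5 * r m" "\<bar>q m - r m - x\<bar> \<le> 5 * r m" using m r_pos[of m] by auto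
    have "r m / 2 \<le> f (q m + r m) - f (q m - r m)"
      using f_ball(1)[of "r m" m] r_pos[of m] by (simp add: power2_eq_square)
    also have "\<dots> \<le> 1 / 30 * \<bar>q m + r m - x\<bar> + 1 / 30 * \<bar>q m - r m - x\<bar>"
      using d(2)[of "q m + r m"] d(2)[of "q m - r m"] y m by linarith
    also have "\<dots> \<le> r m / 3" using y by simp
    finally show False using r_pos[of m] by simp
  next
    case False
    then obtain M where M: "\<And>m. m \<ge> M \<Longrightarrow> \<bar>x - q m\<bar> > 4 * r m"
      by (auto simp: not_frequently eventually_sequentially not_le)
    define S where "S = {m. \<bar>x - q m\<bar> \<le> r m}"
    have "S \<subseteq> {..<M}"
    proof
      fix m assume "m \<in> S"
      then show "m \<in> {..<M}" using M[of m] r_pos[of m] by (force simp: S_def)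
    qed
    then have fin: "finite S" by (rule finite_subset) auto
    \<comment> \<open>Since \<open>r 0 = 1\<close>, ball 0 covers the unit interval.\<close>
    have "0 \<in> S" using x q_in(2,3)[of 0] by (auto simp: S_def r_def)
    define N where "N = Max S"
    have "N \<in> S" unfolding N_def using fin \<open>0 \<in> S\<close> by (intro Max_in) auto
    then have le: "\<bar>x - q N\<bar> \<le> r N" by (simp add: S_def)
    have after: "\<bar>x - q m\<bar> > r m" if "m > N" for m
      using that Max_ge[OF fin, of m] by (force simp: S_def N_def)
    \<comment> \<open>Irrationality of \<open>x\<close> excludes both the centre and the boundary of
      ball \<open>N\<close>, so the wedge value \<open>c\<close> is positive and a neighbourhood of
      \<open>x\<close> stays in the ball.\<close>
    have "x = (if x \<ge> q N then q N + \<bar>x - q N\<bar> else q N - \<bar>x - q N\<bar>)" by auto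
    then have "\<bar>x - q N\<bar> \<notin> \<rat>" using x(3) q_in(1)[of N] by (metis Rats_add Rats_diff)
    then have "\<bar>x - q N\<bar> \<noteq> 0" "\<bar>x - q N\<bar> \<noteq> r N" using r_Rats[of N] Rats_0 by metis+
    then have pos: "0 < \<bar>x - q N\<bar>" "\<bar>x - q N\<bar> < r N" using le by auto
    define c where "c = \<bar>x - q N\<bar> / r N"
    have c: "c > 0" using pos r_pos[of N] by (simp add: c_def)
    \<comment> \<open>The two halves of the interval then contribute at most
      \<open>c * h / 4\<close>, against the lower bound \<open>c * h / 2\<close> derived
      below.\<close>
    obtain d where d: "d > 0" "\<And>y. \<bar>y - x\<bar> < d \<Longrightarrow> \<bar>f y - f x\<bar> \<le> c / 8 * \<bar>y - x\<bar>"
      using has_real_derivative_zero_bound[OF deriv, of "c / 8"] c by auto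
    have ev: "\<forall>\<^sub>F h in at_right 0. h < K" if "K > 0" for K :: real
      using eventually_at_right_real[OF that] by eventually_elim auto
    \<comment> \<open>The interval must stay in ball \<open>N\<close>, keep the wedge at least
      \<open>c / 2\<close>, and avoid the finitely many balls strictly between \<open>N\<close> and
      \<open>M\<close>; 1/10 absorbs a quadratic error.\<close>
    have "\<forall>\<^sub>F h in at_right 0. 0 < h \<and> h < d \<and> h < 1 / 10 \<and> h < r N - \<bar>x - q N\<bar> \<and> h < \<bar>x - q N\<bar> / 2 \<and>
        (\<forall>m\<in>{N<..<M}. h < \<bar>x - q m\<bar> - r m)"
      using d(1) pos after
      by (intro eventually_conj eventually_at_right_less eventually_ball_finite ballI ev) auto
    from eventually_happens'[OF trivial_limit_at_right_real this]
    obtain h where h: "0 < h" "h < d" "h < 1 / 10" "h < r N - \<bar>x - q N\<bar>" "h < \<bar>x - q N\<bar> / 2"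
      and gap: "\<forall>m\<in>{N<..<M}. h < \<bar>x - q m\<bar> - r m"
      by blast
    define a b where "a = x - h" and "b = x + h"
    have ab: "-1 \<le> a" "a \<le> b" using h x by (auto simp: a_def b_def)
    have U: "integral {a..b} (indicator (U N)) \<le> h"
    proof (cases "\<exists>m>N. cball (q m) (r m) \<inter> {a..b} \<noteq> {}")
      case True
      define m where "m = (LEAST m. m > N \<and> cball (q m) (r m) \<inter> {a..b} \<noteq> {})"
      have m: "m > N" "cball (q m) (r m) \<inter> {a..b} \<noteq> {}"
        using LeastI_ex[OF True] by (auto simp: m_def)
      have least: "k \<ge> m" if "k > N" "cball (q k) (r k) \<inter> {a..b} \<noteq> {}" for k
        unfolding m_def using that by (intro Least_le) auto
      have near: "\<bar>x - q m\<bar> \<le> r m + h" using m(2) by (auto simp: a_def b_def dist_real_def)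
      \<comment> \<open>Now \<open>4 * r m < r m + h\<close>, which yields
        \<open>r m \<le> h / 3\<close>.\<close>
      then have "m \<ge> M" using gap m(1) by (force simp: not_le[symmetric])
      then have r3: "r m \<le> h / 3" using M[of m] near by simp
      \<comment> \<open>By minimality every other ball met has index above \<open>m\<close>. The
        radius comes from \<open>r m + 2 * h \<le> 7 * h / 3\<close>.\<close>
      have "U N \<inter> {a..b} \<subseteq> cball (q m) (r m) \<union> (U m \<inter> cball (q m) (7 * h / 3))"
      proof
        fix t assume t: "t \<in> U N \<inter> {a..b}"
        then obtain k where k: "k > N" "t \<in> cball (q k) (r k)" by (auto simp: U_def)
        then have "k \<ge> m" using t by (intro least) auto
        then have "t \<in> cball (q m) (r m) \<union> U m" using k by (cases "k = m") (auto simp: U_def)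
        moreover have "\<bar>x - t\<bar> \<le> h" using t by (auto simp: a_def b_def)
        then have "\<bar>q m - t\<bar> \<le> 7 * h / 3" using near r3 by linarith
        then have "t \<in> cball (q m) (7 * h / 3)" by (simp add: dist_real_def)
        ultimately show "t \<in> cball (q m) (r m) \<union> (U m \<inter> cball (q m) (7 * h / 3))" by auto
      qed
      moreover have "emeasure lborel (cball (q m) (r m) \<union> (U m \<inter> cball (q m) (7 * h / 3))) \<le> ennreal h"
      proof -
        have "emeasure lborel (cball (q m) (r m) \<union> (U m \<inter> cball (q m) (7 * h / 3)))
          \<le> emeasure lborel (cball (q m) (r m)) + emeasure lborel (U m \<inter> cball (q m) (7 * h / 3))"
          using U_borel by (intro emeasure_subadditive) auto
        also have "\<dots> \<le> ennreal (2 * r m) + ennreal ((7 * h / 3)\<^sup>2 / 2)"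
          using measure_U_cball[of "7 * h / 3" m] h r_pos[of m]
          by (intro add_mono) (auto simp: cball_eq_atLeastAtMost)
        also have "\<dots> = ennreal (2 * r m + (7 * h / 3)\<^sup>2 / 2)"
          using r_pos[of m] by (intro ennreal_plus[symmetric]) auto
        also have "\<dots> \<le> ennreal h"
        proof (rule ennreal_leI)
          \<comment> \<open>The two terms are at most \<open>2 * h / 3\<close> and
            \<open>49 * h / 180\<close>.\<close>
          have "h * h \<le> 1 / 10 * h" using h by (intro mult_right_mono) auto
          moreover have "(7 * h / 3)\<^sup>2 / 2 = 49 / 18 * (h * h)" by (simp add: power2_eq_square)
          ultimately show "2 * r m + (7 * h / 3)\<^sup>2 / 2 \<le> h"
            using r3 h(1) by linarith
        qed
        finally show ?thesis .
      qed
      ultimately show ?thesis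
        using h U_borel
        by (intro integral_indicator_U[where A = "cball (q m) (r m) \<union> (U m \<inter> cball (q m) (7 * h / 3))"])
          auto
    next
      case False
      then have "U N \<inter> {a..b} \<subseteq> {}" by (auto simp: U_def)
      then show ?thesis using h by (intro integral_indicator_U[where A = "{}"]) auto
    qed
    \<comment> \<open>Minorant of \<open>g\<close>: \<open>c / 2\<close> off \<open>U N\<close>,
      which leaves measure at least \<open>h\<close> of the length \<open>2 * h\<close>.\<close>
    have "((\<lambda>t. c / 2 * (1 - indicator (U N) t)) has_integral
        (c / 2 * (1 * (b - a) - integral {a..b} (indicator (U N))))) {a..b}"
      using has_integral_const_real[of "1::real" a b] ab
      by (intro has_integral_mult_right has_integral_diff integrable_integral indicator_U_integrable)
        (simp add: mult.commute)
    moreover have "(g has_integral (f b - f a)) {a..b}"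
      unfolding f_diff[OF ab] using g_integrable by (rule integrable_integral)
    ultimately have "c / 2 * (1 * (b - a) - integral {a..b} (indicator (U N))) \<le> f b - f a"
    proof (rule has_integral_le)
      fix t assume t: "t \<in> {a..b}"
      show "c / 2 * (1 - indicator (U N) t) \<le> g t"
      proof (cases "t \<in> U N")
        case False
        have "g t = \<bar>t - q N\<bar> / r N"
          using t h False by (intro g_eq) (auto simp: a_def b_def dist_real_def)
        moreover have "\<bar>x - q N\<bar> / 2 \<le> \<bar>t - q N\<bar>"
          using t h(5) by (cases "q N \<le> x") (auto simp: a_def b_def)
        ultimately show ?thesis using False r_pos[of N] by (simp add: c_def field_simps)
      qed (use g_range in auto)
    qed
    moreover have "c / 2 * h \<le> c / 2 * (1 * (b - a) - integral {a..b} (indicator (U N)))"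
      using U c by (intro mult_left_mono) (auto simp: a_def b_def)
    ultimately have "c / 2 * h \<le> f b - f a" by linarith
    moreover have "\<bar>f a - f x\<bar> \<le> c / 8 * h" "\<bar>f b - f x\<bar> \<le> c / 8 * h"
      using d(2)[of a] d(2)[of b] h(1,2) by (simp_all add: a_def b_def)
    ultimately have "c / 2 * h \<le> c / 8 * h + c / 8 * h" by linarith
    then show False using mult_pos_pos[OF c h(1)] by simp
  qed
qed

text \<open>The endpoints are rational, so an irrational point is interior and its derivative within
  the interval is two-sided.\<close>

lemma f_critical_set:
  "{x \<in> {0..1}. (f has_real_derivative 0) (at x within {0..1})} = \<rat> \<inter> {0..1}"
proof (intro set_eqI iffI)
  fix x assume x: "x \<in> {x \<in> {0..1}. (f has_real_derivative 0) (at x within {0..1})}"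
  have "x \<in> \<rat>"
  proof (rule ccontr)
    assume irr: "x \<notin> \<rat>"
    then have "x \<noteq> 0" "x \<noteq> 1" by auto
    then have "0 < x" "x < 1" using x by auto
    moreover from this have "(f has_real_derivative 0) (at x)"
      using x at_within_Icc_at[of 0 x 1] by simp
    ultimately show False using f_deriv_nonzero irr by blast
  qed
  then show "x \<in> \<rat> \<inter> {0..1}" using x by simp
next
  fix x :: real assume "x \<in> \<rat> \<inter> {0..1}"
  then show "x \<in> {x \<in> {0..1}. (f has_real_derivative 0) (at x within {0..1})}"
    using q_surj[of x] by (auto intro: has_field_derivative_at_within f_deriv_q)
qed

end

section \<open>Density of the rationals and conclusion\<close>

lemma rationals_dense_Icc:
  fixes a b :: real
  assumes "a < b"
  shows "{a..b} \<subseteq> closure (\<rat> \<inter> {a..b})"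
proof -
  \<comment> \<open>Passing to the open interval lets the closure of the rationals be intersected
    with an open set; the outer closure restores the endpoints.\<close>
  have "{a..b} = closure (closure \<rat> \<inter> {a<..<b})" using assms by (simp add: Rats_closure_real)
  also have "\<dots> \<subseteq> closure (\<rat> \<inter> {a<..<b})"
    using open_Int_closure_subset[of "{a<..<b}" \<rat>] by (simp add: Int_commute closure_minimal)
  also have "\<dots> \<subseteq> closure (\<rat> \<inter> {a..b})" by (intro closure_mono) auto
  finally show ?thesis .
qed

theorem theorem1:
  shows "\<exists>f :: real \<Rightarrow> real.
    strict_mono_on {0..1} f \<and>
    absolutely_continuous_on {0..1} f \<and>
    countable {x \<in> {0..1}. (f has_real_derivative 0) (at x within {0..1})} \<and>
    {0..1} \<subseteq> closure {x \<in> {0..1}. (f has_real_derivative 0) (at x within {0..1})}"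
proof -
  have "countable (\<rat> \<inter> {0..1::real})" using countable_rat by blast
  moreover have "infinite (\<rat> \<inter> {0..1::real})"
  proof
    assume "finite (\<rat> \<inter> {0..1::real})"
    then have "finite (closure (\<rat> \<inter> {0..1::real}))" by (simp add: finite_imp_closed)
    then have "finite {0..1::real}" using finite_subset[OF rationals_dense_Icc[of 0 1]] by simp
    then show False using infinite_Icc[of "0::real" 1] by simp
  qed
  ultimately obtain q :: "nat \<Rightarrow> real" where "bij_betw q UNIV (\<rat> \<inter> {0..1})"
    by (rule countable_infiniteE')
  then interpret rational_enumeration q by unfold_locales
  have "absolutely_continuous_on {0..1} f"
    using f_diff_nonneg f_diff_le by (intro absolutely_continuous_on_lipschitz) auto
  then show ?thesis
    using f_strict_mono f_critical_set \<open>countable (\<rat> \<inter> {0..1})\<close> rationals_dense_Icc[of 0 1]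
    by (intro exI[of _ f]) simp
qed

end
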